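(* For every integer $n\ge 1$, $$\mathrm{pf}_n(123,213)=C_{n+1}-C_n,$$ where $C_k=\frac{1}{k+1}\binom{2k}{k}$ is the $k$th Catalan number.
   Context: A Dyck path of semilength $n$ is a lattice path from $(0,0)$ to $(n,n)$ consisting of $n$ north steps $N=(0,1)$ and $n$ east steps $E=(1,0)$ that never goes below the line $y=x$. A parking function of size $n$ is a Dyck path of semilength $n$ whose $n$ north steps are labeled bijectively by $\{1,\dots,n\}$ so that whenever two north steps are consecutive in the path (one immediately following the other), the label of the later one is larger. For a parking function $p$ of size $n$, $\phi(p)$ is the permutation of $\{1,\dots,n\}$ (in one-line notation) obtained by reading the labels of the north steps in the order they occur along the path. A permutation $\pi$ of $\{1,\dots,n\}$ contains a permutation $\rho$ of $\{1,\dots,m\}$ if there are indices $1\le i_1<\cdots<i_m\le n$ such that $\pi_{i_a}\le\pi_{i_b}$ if and only if $\rho_a\le\rho_b$; otherwise $\pi$ avoids $\rho$. For permutations $\rho_1,\dots,\rho_r$, $\mathrm{pf}_n(\rho_1,\dots,\rho_r)$ denotes the number of parking functions $p$ of size $n$ such that $\phi(p)$ avoids each of $\rho_1,\dots,\rho_r$. *)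

theory Defs
  imports Complex_Main
begin

datatype step = N | E

definition pos :: "step list \<Rightarrow> nat \<times> nat" where
  "pos w = (count_list w E, count_list w N)"

definition dyck_path :: "nat \<Rightarrow> step list \<Rightarrow> bool" where
  "dyck_path n w \<longleftrightarrow> pos w = (n, n) \<and>
     (\<forall>k \<le> length w. fst (pos (take k w)) \<le> snd (pos (take k w)))"

text \<open>A path with labelled north steps is a list over the following type.\<close>

datatype lstep = North nat | East

fun unlabel :: "lstep \<Rightarrow> step" where
  "unlabel (North a) = N"
| "unlabel East = E"

fun phi :: "lstep list \<Rightarrow> nat list" where
  "phi [] = []"
| "phi (North a # p) = a # phi p"
| "phi (East # p) = phi p"

definition is_perm :: "nat \<Rightarrow> nat list \<Rightarrow> bool" where
  "is_perm n xs \<longleftrightarrow> distinct xs \<and> set xs = {1..n}"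

text \<open>The labelling of the north steps is bijective onto \<open>{1..n}\<close> precisely when the list of
  labels in path order is a permutation in one-line notation.\<close>

definition parking_function :: "nat \<Rightarrow> lstep list \<Rightarrow> bool" where
  "parking_function n p \<longleftrightarrow>
     dyck_path n (map unlabel p) \<and>
     is_perm n (phi p) \<and>
     (\<forall>i a b. Suc i < length p \<and> p ! i = North a \<and> p ! Suc i = North b \<longrightarrow> a < b)"

text \<open>Positions are counted from 0; entries of a permutation are counted from 1.\<close>

definition perm_contains :: "nat list \<Rightarrow> nat list \<Rightarrow> bool" where
  "perm_contains xs rho \<longleftrightarrow>
     (\<exists>f :: nat \<Rightarrow> nat. strict_mono_on {..<length rho} f \<and> f ` {..<length rho} \<subseteq> {..<length xs} \<and>
        (\<forall>a < length rho. \<forall>b < length rho. xs ! f a \<le> xs ! f b \<longleftrightarrow> rho ! a \<le> rho ! b))"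

definition avoids :: "nat list \<Rightarrow> nat list \<Rightarrow> bool" where
  "avoids xs rho \<longleftrightarrow> \<not> perm_contains xs rho"

definition pf :: "nat \<Rightarrow> nat list set \<Rightarrow> nat" where
  "pf n R = card {p. parking_function n p \<and> (\<forall>rho \<in> R. avoids (phi p) rho)}"

definition catalan :: "nat \<Rightarrow> real" where
  "catalan k = 1 / real (k + 1) * real ((2 * k) choose k)"

end

theory Submission
  imports Defs
begin

text \<open>
  A permutation avoids 123 and 213 iff no entry has two smaller entries before it. Hence the
  maximum stands in first or second position, and deleting it leaves an arbitrary avoiding
  permutation of smaller size. Reading a parking function from left to right, this turns the number
  of completions from height \<open>h\<close>, summed over all avoiding permutations, into the recursion
  \<open>S\<^sub>n(h) = S\<^sub>n(h - 1) + 2 S\<^sub>n\<^sub>-\<^sub>1(h) + S\<^sub>n\<^sub>-\<^sub>2(h + 1)\<close> for the auxiliary sum \<open>path_sum_tl\<close>. Its weights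
  1, 2, 1 are those of two consecutive steps of a simple walk, so the solution is a ballot number;
  the sum for parking functions is a difference of two of its values at height 0.
\<close>

section \<open>Parking functions with a prescribed label sequence\<close>

text \<open>Completions of a partial parking function that stands at height \<open>h\<close> above the diagonal, where
  \<open>c\<close> is the label of the preceding north step, or 0 if the preceding step is not a north step.\<close>

fun labelled_path :: "nat \<Rightarrow> nat \<Rightarrow> lstep list \<Rightarrow> bool" where
  "labelled_path h c [] \<longleftrightarrow> h = 0"
| "labelled_path h c (East # p) \<longleftrightarrow> 0 < h \<and> labelled_path (h - 1) 0 p"
| "labelled_path h c (North a # p) \<longleftrightarrow> c < a \<and> labelled_path (Suc h) a p"

lemma pos_simps:
  "pos [] = (0, 0)"
  "pos (N # w) = (fst (pos w), Suc (snd (pos w)))"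
  "pos (E # w) = (Suc (fst (pos w)), snd (pos w))"
  by (simp_all add: pos_def)

lemma all_le_Suc_iff: "(\<forall>k \<le> Suc n. P k) \<longleftrightarrow> P 0 \<and> (\<forall>k \<le> n. P (Suc k))"
  by (metis Suc_le_mono le0 not0_implies_Suc)

lemma all_nat_split: "(\<forall>i::nat. P i) \<longleftrightarrow> P 0 \<and> (\<forall>i. P (Suc i))"
  by (metis not0_implies_Suc)

definition ascending_runs :: "lstep list \<Rightarrow> bool" where
  "ascending_runs p \<longleftrightarrow>
     (\<forall>i a b. Suc i < length p \<and> p ! i = North a \<and> p ! Suc i = North b \<longrightarrow> a < b)"

lemma ascending_runs_simps:
  "ascending_runs []"
  "ascending_runs (East # p) \<longleftrightarrow> ascending_runs p"
  "ascending_runs (North a # p) \<longleftrightarrow>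
     ascending_runs p \<and> (\<forall>b q. p = North b # q \<longrightarrow> a < b)"
    apply (simp add: ascending_runs_def)
   apply (unfold ascending_runs_def)
   apply (subst all_nat_split, simp)
  apply (subst all_nat_split, cases p; auto)
  done

text \<open>The value \<open>c\<close> constrains only an initial north step; every later comparison
  of labels is part of \<open>ascending_runs\<close>. Labels must be nonzero so that the reset to 0
  after an east step imposes no condition.\<close>

lemma labelled_path_iff:
  assumes "0 \<notin> set (phi p)"
  shows "labelled_path h c p \<longleftrightarrow>
    h + snd (pos (map unlabel p)) = fst (pos (map unlabel p)) \<and>
    (\<forall>k \<le> length p. fst (pos (take k (map unlabel p))) \<le> h + snd (pos (take k (map unlabel p)))) \<and>
    ascending_runs p \<and> (\<forall>b q. p = North b # q \<longrightarrow> c < b)"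
  using assms
proof (induction h c p rule: labelled_path.induct)
  case (1 h c)
  then show ?case by (simp add: pos_simps ascending_runs_simps)
next
  case (2 h c p)
  have first: "\<forall>b q. p = North b # q \<longrightarrow> 0 < b" using 2 by auto
  show ?case
  proof (cases h)
    case 0
    \<comment> \<open>From height 0 the prefix consisting of this east step alone is already below
      the diagonal.\<close>
    have "\<not> (\<forall>k \<le> length (East # p). fst (pos (take k (map unlabel (East # p))))
        \<le> 0 + snd (pos (take k (map unlabel (East # p)))))"
      unfolding length_Cons all_le_Suc_iff by (auto simp: pos_simps intro!: exI[of _ 0])
    then show ?thesis using 0 by simp
  next
    case (Suc h')
    then show ?thesis using 2 first
      by (simp add: pos_simps all_le_Suc_iff ascending_runs_simps)
  qed
next
  case (3 h c a p)
  then show ?case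
    by (auto simp: pos_simps all_le_Suc_iff ascending_runs_simps)
qed

lemma parking_function_iff:
  "parking_function n p \<longleftrightarrow> labelled_path 0 0 p \<and> is_perm n (phi p)"
proof (cases "is_perm n (phi p)")
  case True
  have "length (phi p) = snd (pos (map unlabel p))"
    by (induction p rule: phi.induct) (simp_all add: pos_simps)
  then have "snd (pos (map unlabel p)) = n"
    using True distinct_card[of "phi p"] by (auto simp: is_perm_def)
  moreover have z: "0 \<notin> set (phi p)" using True by (auto simp: is_perm_def)
  moreover have "\<forall>b q. p = North b # q \<longrightarrow> 0 < b" using z by auto
  ultimately show ?thesis using True
    unfolding parking_function_def labelled_path_iff[OF z] dyck_path_def ascending_runs_def
    by (auto simp: prod_eq_iff)
next
  case False
  then show ?thesis by (simp add: parking_function_def)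
qed

text \<open>The next step is east or carries the label \<open>a\<close>. Once no labels remain, the
  \<open>h\<close> closing east steps are forced, hence the value 1.\<close>

fun num_paths :: "nat \<Rightarrow> nat \<Rightarrow> nat list \<Rightarrow> nat" where
  "num_paths h c [] = 1"
| "num_paths h c (a # xs) =
     (if h = 0 then 0 else num_paths (h - 1) 0 (a # xs)) + (if c < a then num_paths (Suc h) a xs else 0)"

text \<open>Splitting by the first step gives the recursion of \<open>num_paths\<close>. Finiteness
  is proved along with it because the cardinality of the disjoint union requires it.\<close>

lemma finite_card_labelled_paths:
  "finite {p. labelled_path h c p \<and> phi p = xs} \<and>
   card {p. labelled_path h c p \<and> phi p = xs} = num_paths h c xs"
proof (induction h c xs rule: num_paths.induct)
  case (1 h c)
  have "labelled_path h c p \<and> phi p = [] \<longleftrightarrow> p = replicate h East" for p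
  proof (induction h c p rule: labelled_path.induct)
    case (2 h c p)
    then show ?case by (cases h) auto
  next
    case (3 h c a p)
    then show ?case by (cases h) auto
  qed auto
  then show ?case by simp
next
  case (2 h c a xs)
  let ?P = "\<lambda>h c xs. {p. labelled_path h c p \<and> phi p = xs}"
  have eq: "?P h c (a # xs) = (if h = 0 then {} else Cons East ` ?P (h - 1) 0 (a # xs)) \<union>
      (if c < a then Cons (North a) ` ?P (Suc h) a xs else {})" (is "_ = ?A \<union> ?B")
  proof (rule set_eqI)
    fix p show "p \<in> ?P h c (a # xs) \<longleftrightarrow> p \<in> ?A \<union> ?B"
      by (cases p rule: phi.cases) auto
  qed
  have A: "finite ?A" "card ?A = (if h = 0 then 0 else num_paths (h - 1) 0 (a # xs))"
    using 2 by (simp_all add: card_image)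
  have B: "finite ?B" "card ?B = (if c < a then num_paths (Suc h) a xs else 0)"
    using 2 by (simp_all add: card_image)
  have "?A \<inter> ?B = {}" by auto
  then show ?case unfolding eq using A B by (simp add: card_Un_disjoint)
qed

text \<open>After the label \<open>m\<close> an east step is forced, unless no labels remain; in that case both sides
  are 1 since only east steps follow.\<close>

lemma num_paths_descent:
  assumes "\<forall>x \<in> set xs. x < m"
  shows "num_paths (Suc h) m xs = num_paths h 0 xs"
  using assms by (cases xs) auto

section \<open>Avoidance of 123 and 213 as a single condition\<close>

text \<open>The patterns 123 and 213 differ only in the order of their first two entries, which is
  left open here.\<close>

definition dominates_two :: "nat list \<Rightarrow> bool" where
  "dominates_two xs \<longleftrightarrow>
     (\<exists>i j k. i < j \<and> j < k \<and> k < length xs \<and> xs ! i < xs ! k \<and> xs ! j < xs ! k)"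

lemma perm_contains_3_iff:
  "perm_contains xs [r, s, t] \<longleftrightarrow>
    (\<exists>i j k. i < j \<and> j < k \<and> k < length xs \<and>
      (\<forall>(x, u) \<in> {(xs ! i, r), (xs ! j, s), (xs ! k, t)}.
       \<forall>(y, v) \<in> {(xs ! i, r), (xs ! j, s), (xs ! k, t)}. x \<le> y \<longleftrightarrow> u \<le> v))"
  (is "?L \<longleftrightarrow> ?R")
proof -
  have idx: "{..<length [r, s, t]} = {0, 1, 2}" by auto
  have all: "(\<forall>a < length [r, s, t]. P a) \<longleftrightarrow> P 0 \<and> P 1 \<and> P 2" for P
    using idx by (metis insert_iff lessThan_iff singletonD)
  show ?thesis
  proof
    assume ?L
    then obtain f where f: "strict_mono_on {0, 1, 2} f" "f ` {0, 1, 2} \<subseteq> {..<length xs}"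
      "\<forall>a < length [r, s, t]. \<forall>b < length [r, s, t]. xs ! f a \<le> xs ! f b \<longleftrightarrow> [r, s, t] ! a \<le> [r, s, t] ! b"
      unfolding perm_contains_def idx by blast
    have "f 0 < f 1" "f 1 < f (2::nat)"
      using f(1) by (auto simp: strict_mono_on_def)
    then show ?R using f(2) f(3)[unfolded all]
      by (intro exI[of _ "f 0"] exI[of _ "f 1"] exI[of _ "f 2"]) (simp add: numeral_2_eq_2)
  next
    assume ?R
    then obtain i j k where ijk: "i < j" "j < k" "k < length xs"
      and ord: "\<forall>(x, u) \<in> {(xs ! i, r), (xs ! j, s), (xs ! k, t)}.
       \<forall>(y, v) \<in> {(xs ! i, r), (xs ! j, s), (xs ! k, t)}. x \<le> y \<longleftrightarrow> u \<le> v" by blast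
    define f :: "nat \<Rightarrow> nat" where "f = (\<lambda>a. [i, j, k] ! a)"
    have "strict_mono_on {0, 1, 2} f" "f ` {0, 1, 2} \<subseteq> {..<length xs}"
      using ijk by (auto simp: strict_mono_on_def f_def)
    moreover have "\<forall>a < length [r, s, t]. \<forall>b < length [r, s, t].
        xs ! f a \<le> xs ! f b \<longleftrightarrow> [r, s, t] ! a \<le> [r, s, t] ! b"
      unfolding all f_def using ord by (simp add: numeral_2_eq_2)
    ultimately show ?L unfolding perm_contains_def idx by blast
  qed
qed

lemma avoids_123_213_iff:
  assumes "distinct xs"
  shows "avoids xs [1, 2, 3] \<and> avoids xs [2, 1, 3] \<longleftrightarrow> \<not> dominates_two xs"
proof -
  have "perm_contains xs [1, 2, 3] \<or> perm_contains xs [2, 1, 3]" if "dominates_two xs"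
  proof -
    from that obtain i j k where ijk: "i < j" "j < k" "k < length xs" "xs ! i < xs ! k" "xs ! j < xs ! k"
      unfolding dominates_two_def by blast
    \<comment> \<open>The order of the two smaller entries decides which of the two patterns
      occurs.\<close>
    moreover have "xs ! i \<noteq> xs ! j" using ijk assms by (simp add: nth_eq_iff_index_eq)
    ultimately consider "xs ! i < xs ! j" | "xs ! j < xs ! i" by linarith
    then show ?thesis
    proof cases
      case 1
      then have "perm_contains xs [1, 2, 3]" unfolding perm_contains_3_iff using ijk
        by (intro exI[of _ i] exI[of _ j] exI[of _ k]) simp
      then show ?thesis ..
    next
      case 2
      then have "perm_contains xs [2, 1, 3]" unfolding perm_contains_3_iff using ijk
        by (intro exI[of _ i] exI[of _ j] exI[of _ k]) simp
      then show ?thesis ..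
    qed
  qed
  \<comment> \<open>Only one feature of the patterns is used: the last of the three entries is the
    largest.\<close>
  moreover have "dominates_two xs"
    if contains: "perm_contains xs [r, s, t]" and less: "r < t" "s < t" for r s t
  proof -
    obtain i j k where ijk: "i < j" "j < k" "k < length xs"
      and ord: "\<forall>(x, u) \<in> {(xs ! i, r), (xs ! j, s), (xs ! k, t)}.
        \<forall>(y, v) \<in> {(xs ! i, r), (xs ! j, s), (xs ! k, t)}. x \<le> y \<longleftrightarrow> u \<le> v"
      using contains unfolding perm_contains_3_iff by blast
    have "xs ! k \<le> xs ! i \<longleftrightarrow> t \<le> r" "xs ! k \<le> xs ! j \<longleftrightarrow> t \<le> s"
      using ord by simp_all
    then show ?thesis using ijk less unfolding dominates_two_def
      by (intro exI[of _ i] exI[of _ j] exI[of _ k]) (simp add: not_le[symmetric])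
  qed
  from this[of 1 2 3] this[of 2 1 3]
  have "dominates_two xs" if "perm_contains xs [1, 2, 3] \<or> perm_contains xs [2, 1, 3]"
    using that by auto
  ultimately show ?thesis unfolding avoids_def by blast
qed

lemma dominates_two_Cons:
  "dominates_two (x # xs) \<longleftrightarrow> dominates_two xs \<or>
    (\<exists>j k. j < k \<and> k < length xs \<and> x < xs ! k \<and> xs ! j < xs ! k)"
proof
  assume "dominates_two (x # xs)"
  then obtain i j k where ijk: "i < j" "j < k" "k < length (x # xs)"
      "(x # xs) ! i < (x # xs) ! k" "(x # xs) ! j < (x # xs) ! k"
    unfolding dominates_two_def by blast
  then obtain j' k' where "j = Suc j'" "k = Suc k'" by (metis less_imp_Suc_add)
  then show "dominates_two xs \<or> (\<exists>j k. j < k \<and> k < length xs \<and> x < xs ! k \<and> xs ! j < xs ! k)"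
    using ijk unfolding dominates_two_def by (cases i) auto
next
  assume "dominates_two xs \<or> (\<exists>j k. j < k \<and> k < length xs \<and> x < xs ! k \<and> xs ! j < xs ! k)"
  then show "dominates_two (x # xs)"
  proof (elim disjE exE conjE)
    assume "dominates_two xs"
    then obtain i j k where "i < j" "j < k" "k < length xs" "xs ! i < xs ! k" "xs ! j < xs ! k"
      unfolding dominates_two_def by blast
    then show ?thesis unfolding dominates_two_def
      by (intro exI[of _ "Suc i"] exI[of _ "Suc j"] exI[of _ "Suc k"]) simp
  next
    fix j k assume "j < k" "k < length xs" "x < xs ! k" "xs ! j < xs ! k"
    then show ?thesis unfolding dominates_two_def
      by (intro exI[of _ 0] exI[of _ "Suc j"] exI[of _ "Suc k"]) simp
  qed
qed

text \<open>A maximum in front is smaller than no later entry and has nothing before it.\<close>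

lemma dominates_two_Cons_max:
  assumes "\<forall>x \<in> set xs. x < m"
  shows "dominates_two (m # xs) \<longleftrightarrow> dominates_two xs"
  using assms unfolding dominates_two_Cons by (meson nth_mem order_less_asym order_less_trans)

text \<open>A maximum in second position has only one entry before it and is smaller than no later
  entry, so it takes part in no offending triple.\<close>

lemma dominates_two_Cons_Cons_max:
  assumes "\<forall>x \<in> set xs. x < m"
  shows "dominates_two (b # m # xs) \<longleftrightarrow> dominates_two (b # xs)"
proof -
  have "(\<exists>j k. j < k \<and> k < length (m # xs) \<and> b < (m # xs) ! k \<and> (m # xs) ! j < (m # xs) ! k) \<longleftrightarrow>
        (\<exists>j k. j < k \<and> k < length xs \<and> b < xs ! k \<and> xs ! j < xs ! k)" (is "?L \<longleftrightarrow> ?R")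
  proof
    assume ?L
    then obtain j k where jk: "j < k" "k < length (m # xs)" "b < (m # xs) ! k" "(m # xs) ! j < (m # xs) ! k"
      by blast
    obtain k' where k: "k = Suc k'" using jk by (cases k) auto
    have "xs ! k' < m" using jk k assms by auto
    then obtain j' where "j = Suc j'" using jk k by (cases j) auto
    then show ?R using jk k by auto
  next
    assume ?R
    then obtain j k where "j < k" "k < length xs" "b < xs ! k" "xs ! j < xs ! k" by blast
    then show ?L by (intro exI[of _ "Suc j"] exI[of _ "Suc k"]) simp
  qed
  then show ?thesis
    using dominates_two_Cons[of b "m # xs"] dominates_two_Cons[of b xs] dominates_two_Cons_max[OF assms] by simp
qed

section \<open>Generating the avoiders by inserting the maximum\<close>

text \<open>Applied only to avoiders of positive size, so \<open>hd\<close> is always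
  meaningful.\<close>

definition insert_second :: "nat \<Rightarrow> nat list \<Rightarrow> nat list" where
  "insert_second m xs = hd xs # m # tl xs"

text \<open>Size 1 is a separate base case because the empty list has no second position for the
  maximum.\<close>

fun avoiders :: "nat \<Rightarrow> nat list set" where
  "avoiders 0 = {[]}"
| "avoiders (Suc 0) = {[1]}"
| "avoiders (Suc (Suc n)) =
     Cons (Suc (Suc n)) ` avoiders (Suc n) \<union> insert_second (Suc (Suc n)) ` avoiders (Suc n)"

lemma is_perm_Cons_max: "is_perm (Suc n) (Suc n # xs) \<longleftrightarrow> is_perm n xs"
proof -
  have range: "{1..Suc n} = insert (Suc n) {1..n}" and fresh: "Suc n \<notin> {1..n}" by auto
  show ?thesis
  proof
    assume "is_perm (Suc n) (Suc n # xs)"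
    then have "distinct xs" "Suc n \<notin> set xs" "insert (Suc n) (set xs) = insert (Suc n) {1..n}"
      unfolding is_perm_def range by auto
    then show "is_perm n xs" using fresh by (simp add: is_perm_def insert_ident)
  next
    assume "is_perm n xs"
    then show "is_perm (Suc n) (Suc n # xs)" using fresh unfolding is_perm_def range by simp
  qed
qed

lemma is_perm_Cons_Cons_max: "is_perm (Suc n) (b # Suc n # xs) \<longleftrightarrow> is_perm n (b # xs)"
proof -
  have "is_perm (Suc n) (b # Suc n # xs) \<longleftrightarrow> is_perm (Suc n) (Suc n # b # xs)"
    unfolding is_perm_def by (auto simp: insert_commute)
  then show ?thesis by (simp add: is_perm_Cons_max)
qed

text \<open>A maximum at index 2 or later would exceed the entries at indices 0 and 1.\<close>

lemma max_position:
  assumes "is_perm (Suc n) xs" "\<not> dominates_two xs"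
  shows "(\<exists>ys. xs = Suc n # ys) \<or> (\<exists>b ys. xs = b # Suc n # ys)"
proof -
  have "Suc n \<in> set xs" using assms by (simp add: is_perm_def)
  then obtain k where k: "k < length xs" "xs ! k = Suc n" by (auto simp: in_set_conv_nth)
  have smaller: "xs ! i < Suc n" if "i < k" for i
  proof -
    have "xs ! i \<noteq> xs ! k"
      using that k(1) assms(1) by (simp add: is_perm_def nth_eq_iff_index_eq)
    moreover have "xs ! i \<in> {1..Suc n}"
      using that k(1) assms(1) nth_mem[of i xs] unfolding is_perm_def by auto
    ultimately show ?thesis using k(2) by auto
  qed
  have "k < 2"
  proof (rule ccontr)
    assume "\<not> k < 2"
    then have "dominates_two xs" unfolding dominates_two_def using k smaller
      by (intro exI[of _ 0] exI[of _ 1] exI[of _ k]) auto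
    then show False using assms by simp
  qed
  then consider "k = 0" | "k = 1" by linarith
  then show ?thesis
  proof cases
    case 1
    then show ?thesis using k by (cases xs) auto
  next
    case 2
    then show ?thesis using k by (cases xs; cases "tl xs") auto
  qed
qed

text \<open>By \<open>max_position\<close> the maximum is first or second, and in both places
  removing or inserting it preserves avoidance.\<close>

lemma avoiders_eq: "avoiders n = {xs. is_perm n xs \<and> \<not> dominates_two xs}"
proof (induction n rule: avoiders.induct)
  case 1
  then show ?case by (auto simp: is_perm_def dominates_two_def)
next
  case 2
  have "is_perm (Suc 0) xs \<longleftrightarrow> xs = [1]" for xs
  proof
    assume xs: "is_perm (Suc 0) xs"
    then have "length xs = 1" using distinct_card[of xs] by (simp add: is_perm_def)
    then obtain a where "xs = [a]" by (auto simp: length_Suc_conv)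
    then show "xs = [1]" using xs by (simp add: is_perm_def)
  qed (simp add: is_perm_def)
  moreover have "\<not> dominates_two [1]" by (simp add: dominates_two_def)
  ultimately show ?case by auto
next
  case (3 n)
  let ?m = "Suc (Suc n)"
  have lt: "\<forall>x \<in> set xs. x < ?m" if "is_perm (Suc n) xs" for xs
    using that by (auto simp: is_perm_def)
  show ?case
  proof (intro set_eqI iffI)
    fix xs assume "xs \<in> avoiders ?m"
    then consider ys where "ys \<in> avoiders (Suc n)" "xs = ?m # ys"
      | ys where "ys \<in> avoiders (Suc n)" "xs = insert_second ?m ys" by auto
    then show "xs \<in> {xs. is_perm ?m xs \<and> \<not> dominates_two xs}"
    proof cases
      case 1
      then show ?thesis using 3 lt[of ys] by (simp add: is_perm_Cons_max dominates_two_Cons_max)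
    next
      case 2
      then have "ys \<noteq> []" using 3 by (auto simp: is_perm_def)
      then obtain b zs where ys: "ys = b # zs" by (cases ys) auto
      then show ?thesis using 2 3 lt[of ys]
        by (simp add: insert_second_def is_perm_Cons_Cons_max dominates_two_Cons_Cons_max)
    qed
  next
    fix xs assume "xs \<in> {xs. is_perm ?m xs \<and> \<not> dominates_two xs}"
    then have xs: "is_perm ?m xs" "\<not> dominates_two xs" by auto
    from max_position[OF xs] consider ys where "xs = ?m # ys" | b ys where "xs = b # ?m # ys" by blast
    then show "xs \<in> avoiders ?m"
    proof cases
      case 1
      then have "ys \<in> avoiders (Suc n)"
        using xs 3 lt[of ys] by (simp add: is_perm_Cons_max dominates_two_Cons_max)
      then show ?thesis using 1 by simp
    next
      case 2
      then have "b # ys \<in> avoiders (Suc n)"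
        using xs 3 lt[of "b # ys"] by (simp add: is_perm_Cons_Cons_max dominates_two_Cons_Cons_max)
      moreover have "xs = insert_second ?m (b # ys)" using 2 by (simp add: insert_second_def)
      ultimately show ?thesis by auto
    qed
  qed
qed

lemma finite_avoiders: "finite (avoiders n)"
  by (induction n rule: avoiders.induct) auto

lemma avoidersD:
  assumes "xs \<in> avoiders (Suc n)"
  shows "xs \<noteq> []" "\<forall>x \<in> set xs. 0 < x \<and> x < Suc (Suc n)"
  using assms by (auto simp: avoiders_eq is_perm_def)

lemma sum_avoiders_Suc_Suc:
  fixes f :: "nat list \<Rightarrow> nat"
  shows "(\<Sum>xs \<in> avoiders (Suc (Suc n)). f xs) =
    (\<Sum>xs \<in> avoiders (Suc n). f (Suc (Suc n) # xs) + f (insert_second (Suc (Suc n)) xs))"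
proof -
  let ?m = "Suc (Suc n)"
  have "Cons ?m ` avoiders (Suc n) \<inter> insert_second ?m ` avoiders (Suc n) = {}"
  proof -
    \<comment> \<open>The first entry separates the two images: it is the maximum in one and smaller
      in the other.\<close>
    have "hd xs < ?m" if "xs \<in> avoiders (Suc n)" for xs
      using avoidersD[OF that] by auto
    then show ?thesis by (fastforce simp: insert_second_def)
  qed
  moreover have "inj_on (insert_second ?m) (avoiders (Suc n))"
    using avoidersD(1) by (auto simp: inj_on_def insert_second_def intro: list.expand)
  ultimately show ?thesis
    by (simp add: sum.union_disjoint finite_avoiders sum.reindex sum.distrib)
qed

section \<open>Recursions for the sums over all avoiders\<close>

text \<open>Height 0 gives the number sought; the recursions need all heights.\<close>

definition path_sum :: "nat \<Rightarrow> nat \<Rightarrow> nat" where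
  "path_sum n h = (\<Sum>xs \<in> avoiders n. num_paths h 0 xs)"

text \<open>The first label \<open>hd xs\<close> is replaced by a maximum: this is what remains to be read of
  \<open>insert_second (Suc n) xs\<close> once its first label and an east step have been read.\<close>

definition path_sum_max_first :: "nat \<Rightarrow> nat \<Rightarrow> nat" where
  "path_sum_max_first n h = (\<Sum>xs \<in> avoiders n. num_paths h 0 (Suc n # tl xs))"

definition path_sum_tl :: "nat \<Rightarrow> nat \<Rightarrow> nat" where
  "path_sum_tl n h = (\<Sum>xs \<in> avoiders n. num_paths h 0 (tl xs))"

lemma path_sum_tl_1: "path_sum_tl (Suc 0) h = 1"
  by (simp add: path_sum_tl_def)

text \<open>Dropping the first entry of \<open>m # xs\<close> leaves \<open>xs\<close>, and dropping
  that of \<open>insert_second m xs\<close> leaves \<open>m # tl xs\<close>.\<close>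

lemma path_sum_tl_Suc_Suc: "path_sum_tl (Suc (Suc n)) h = path_sum (Suc n) h + path_sum_max_first (Suc n) h"
  by (simp add: path_sum_tl_def path_sum_def path_sum_max_first_def sum_avoiders_Suc_Suc insert_second_def
      sum.distrib del: num_paths.simps avoiders.simps)

lemma num_paths_tl_descent:
  assumes "xs \<in> avoiders (Suc n)"
  shows "num_paths (Suc h) (Suc (Suc n)) (tl xs) = num_paths h 0 (tl xs)"
  using avoidersD[OF assms] by (intro num_paths_descent) (auto dest: list.set_sel(2))

text \<open>Either an east step comes first, or the maximum is read and the descent after it brings
  the height back to \<open>h\<close>.\<close>

lemma path_sum_max_first_rec:
  "path_sum_max_first (Suc n) h =
    (if h = 0 then 0 else path_sum_max_first (Suc n) (h - 1)) + path_sum_tl (Suc n) h"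
proof -
  have "num_paths h 0 (Suc (Suc n) # tl xs) =
      (if h = 0 then 0 else num_paths (h - 1) 0 (Suc (Suc n) # tl xs)) + num_paths h 0 (tl xs)"
    if "xs \<in> avoiders (Suc n)" for xs
    using num_paths_tl_descent[OF that, of h] by simp
  then show ?thesis
    by (simp add: path_sum_max_first_def path_sum_tl_def sum.distrib del: num_paths.simps avoiders.simps)
qed

lemma path_sum_1: "path_sum (Suc 0) h = Suc h"
  by (induction h) (simp_all add: path_sum_def)

text \<open>The first summand collects the paths starting with an east step. If the maximum
  \<open>m\<close> is read first, \<open>path_sum (Suc n) h\<close> remains. If \<open>m\<close> is
  second, the first label is followed by an east step, giving
  \<open>path_sum_max_first (Suc n) h\<close>, or directly by \<open>m\<close>, giving the last
  summand. The two middle sums combine by \<open>path_sum_tl_Suc_Suc\<close>.\<close>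

lemma path_sum_Suc_Suc:
  "path_sum (Suc (Suc n)) h = (if h = 0 then 0 else path_sum (Suc (Suc n)) (h - 1)) +
     path_sum_tl (Suc (Suc n)) h + path_sum_tl (Suc n) (Suc h)"
proof -
  let ?m = "Suc (Suc n)" and ?K = "\<lambda>h xs. if h = 0 then 0 else num_paths (h - 1) 0 xs"
  have *: "num_paths h 0 (?m # xs) = ?K h (?m # xs) + num_paths h 0 xs \<and>
     num_paths h 0 (insert_second ?m xs) = ?K h (insert_second ?m xs) +
       num_paths h 0 (?m # tl xs) + num_paths (Suc h) 0 (tl xs)"
    if "xs \<in> avoiders (Suc n)" for xs
  proof
    have "num_paths (Suc h) ?m xs = num_paths h 0 xs"
      using avoidersD[OF that] by (intro num_paths_descent) auto
    then show "num_paths h 0 (?m # xs) = ?K h (?m # xs) + num_paths h 0 xs" by simp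
    \<comment> \<open>These bounds permit the north step labelled \<open>hd xs\<close> and, directly
      after it, the one labelled \<open>?m\<close>.\<close>
    have "0 < hd xs" "hd xs < ?m" using avoidersD[OF that] by auto
    then show "num_paths h 0 (insert_second ?m xs) = ?K h (insert_second ?m xs) +
       num_paths h 0 (?m # tl xs) + num_paths (Suc h) 0 (tl xs)"
      using num_paths_tl_descent[OF that] by (simp add: insert_second_def)
  qed
  have K: "(\<Sum>xs \<in> avoiders (Suc n). ?K h (?m # xs) + ?K h (insert_second ?m xs)) =
      (if h = 0 then 0 else path_sum ?m (h - 1))"
    by (simp add: path_sum_def sum_avoiders_Suc_Suc del: num_paths.simps avoiders.simps)
  have "path_sum ?m h = (\<Sum>xs \<in> avoiders (Suc n). (?K h (?m # xs) + ?K h (insert_second ?m xs)) +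
     (num_paths h 0 xs + num_paths h 0 (?m # tl xs) + num_paths (Suc h) 0 (tl xs)))"
    unfolding path_sum_def sum_avoiders_Suc_Suc
    by (rule sum.cong[OF refl]) (use * in \<open>simp only: add_ac\<close>)
  also have "\<dots> = (if h = 0 then 0 else path_sum ?m (h - 1)) +
      (path_sum (Suc n) h + path_sum_max_first (Suc n) h + path_sum_tl (Suc n) (Suc h))"
    unfolding sum.distrib[of "\<lambda>xs. ?K h (?m # xs) + ?K h (insert_second ?m xs)"] K
    by (simp add: path_sum_def path_sum_max_first_def path_sum_tl_def sum.distrib del: num_paths.simps avoiders.simps)
  finally show ?thesis by (simp add: path_sum_tl_Suc_Suc)
qed

section \<open>Ballot numbers and Catalan numbers\<close>

text \<open>By the reflection principle, for \<open>2 * k \<le> m\<close> this counts the walks with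
  \<open>m - k\<close> up steps and \<open>k\<close> down steps that never go below 0. The case
  \<open>k = 0\<close> is separate because \<open>k - 1\<close> truncates.\<close>

definition ballot :: "nat \<Rightarrow> nat \<Rightarrow> real" where
  "ballot m k = real (m choose k) - (if k = 0 then 0 else real (m choose (k - 1)))"

lemma ballot_0: "ballot m 0 = 1"
  by (simp add: ballot_def)

lemma ballot_Suc_Suc: "ballot (Suc m) (Suc k) = ballot m (Suc k) + ballot m k"
  by (cases k) (simp_all add: ballot_def)

text \<open>The boundary value that replaces the missing term for height -1 in the
  recursion.\<close>

lemma ballot_middle: "ballot (Suc (2 * k)) (Suc k) = 0"
  using binomial_symmetric[of k "Suc (2 * k)"] by (simp add: ballot_def)

text \<open>The recursions for \<open>path_sum\<close> and \<open>path_sum_max_first\<close> are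
  added. Their terms at \<open>h - 1\<close> recombine, and each contributes one copy of
  \<open>path_sum_tl (Suc (Suc n)) h\<close>.\<close>

lemma path_sum_tl_rec:
  "path_sum_tl (Suc (Suc (Suc n))) h = (if h = 0 then 0 else path_sum_tl (Suc (Suc (Suc n))) (h - 1)) +
     2 * path_sum_tl (Suc (Suc n)) h + path_sum_tl (Suc n) (Suc h)"
  unfolding path_sum_tl_Suc_Suc[of "Suc n"]
  using path_sum_Suc_Suc[of n h] path_sum_max_first_rec[of "Suc n" h] by simp

lemma path_sum_tl_eq_ballot: "real (path_sum_tl (Suc n) h) = ballot (2 * n + 2 * h + 1) n"
proof (induction n arbitrary: h rule: less_induct)
  case (less n)
  \<comment> \<open>The recursion reaches back two sizes, so two base cases are needed.\<close>
  consider "n = 0" | "n = 1" | k where "n = Suc (Suc k)"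
    by (metis One_nat_def not0_implies_Suc)
  then show ?case
  proof cases
    case 1
    then show ?thesis by (simp add: path_sum_tl_1 ballot_0)
  next
    case 2
    have "path_sum_max_first (Suc 0) h = Suc h"
      by (induction h) (simp_all add: path_sum_max_first_def)
    then show ?thesis using 2 by (simp add: path_sum_tl_Suc_Suc path_sum_1 ballot_def)
  next
    case 3
    \<comment> \<open>Pascal's rule applied twice; all three terms on the right lie in row
      \<open>2 * n + 2 * h - 1\<close>.\<close>
    have step: "ballot (2 * n + 2 * h + 1) n =
      ballot (2 * n + 2 * h - 1) n + 2 * ballot (2 * (n - 1) + 2 * h + 1) (n - 1) +
      ballot (2 * k + 2 * Suc h + 1) k" for h
      using 3 by (simp add: ballot_Suc_Suc)
    note IH = less[of "Suc k", simplified 3] less[of k, simplified 3]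
    show ?thesis
    proof (induction h)
      case 0
      have "ballot (2 * n - 1) n = 0" using ballot_middle[of "Suc k"] 3 by simp
      then show ?case using step[of 0] IH(1)[of 0] IH(2)[of 1] path_sum_tl_rec[of k 0] 3 by simp
    next
      case (Suc h)
      then show ?case
        using step[of "Suc h"] IH(1)[of "Suc h"] IH(2)[of "Suc (Suc h)"] path_sum_tl_rec[of k "Suc h"] 3
        by simp
    qed
  qed
qed

text \<open>With \<open>x\<close> and \<open>y\<close> the two binomials of the difference,
  absorption gives \<open>n * x = (n + 2) * y\<close>, that is
  \<open>2 * x = (n + 2) * (x - y)\<close>, and \<open>2 * x\<close> is the central binomial
  coefficient of \<open>catalan (n + 1)\<close>.\<close>

lemma ballot_eq_catalan: "ballot (2 * n + 1) n = catalan (n + 1)"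
proof (cases n)
  case 0
  then show ?thesis by (simp add: ballot_def catalan_def)
next
  case (Suc m)
  define x y where "x = real ((2 * n + 1) choose n)" and "y = real ((2 * n + 1) choose m)"
  have "Suc m * ((2 * n + 1) choose Suc m) = (2 * n + 1 - m) * ((2 * n + 1) choose m)"
    by (metis binomial_absorb_comp binomial_absorption Suc_eq_plus1 diff_Suc_1)
  moreover have "2 * n + 1 - m = n + 2" using Suc by simp
  ultimately have "n * ((2 * n + 1) choose n) = (n + 2) * ((2 * n + 1) choose m)"
    using Suc by metis
  then have "real n * x = (real n + 2) * y"
    unfolding x_def y_def by (metis of_nat_add of_nat_mult of_nat_numeral)
  \<comment> \<open>Pascal's rule splits the central coefficient into two entries that are equal by
    symmetry.\<close>
  moreover have "real ((2 * (n + 1)) choose (n + 1)) = 2 * x"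
    using binomial_symmetric[of n "Suc (2 * n)"] by (simp add: x_def)
  moreover have "ballot (2 * n + 1) n = x - y" using Suc by (simp add: ballot_def x_def y_def)
  moreover have "2 * x = (real n + 2) * (x - y)" using calculation(1) by (simp add: algebra_simps)
  ultimately show ?thesis unfolding catalan_def by (simp add: add.commute)
qed

section \<open>Counting the parking functions\<close>

text \<open>Parking functions are grouped by \<open>phi p\<close>; the groups are disjoint and each
  is counted by \<open>num_paths\<close>.\<close>

lemma pf_eq_total: "pf n {[1, 2, 3], [2, 1, 3]} = path_sum n 0"
proof -
  have "{p. parking_function n p \<and> (\<forall>rho \<in> {[1, 2, 3], [2, 1, 3]}. avoids (phi p) rho)} =
      (\<Union>xs \<in> avoiders n. {p. labelled_path 0 0 p \<and> phi p = xs})"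
  proof -
    have "is_perm n (phi p) \<Longrightarrow> distinct (phi p)" for p by (simp add: is_perm_def)
    then show ?thesis using avoids_123_213_iff
      by (fastforce simp: parking_function_iff avoiders_eq)
  qed
  also have "card \<dots> = (\<Sum>xs \<in> avoiders n. card {p. labelled_path 0 0 p \<and> phi p = xs})"
    by (rule card_UN_disjoint) (use finite_avoiders finite_card_labelled_paths in auto)
  finally show ?thesis by (simp add: pf_def path_sum_def finite_card_labelled_paths)
qed

theorem theorem21:
  fixes n :: nat
  assumes "n \<ge> 1"
  shows "real (pf n {[1, 2, 3], [2, 1, 3]}) = catalan (n + 1) - catalan n"
proof -
  obtain k where n: "n = Suc k" using assms by (cases n) auto
  \<comment> \<open>At height 0 no east step is possible, so \<open>path_sum_max_first n 0\<close>
    reduces to \<open>path_sum_tl n 0\<close>.\<close>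
  have "path_sum n 0 + path_sum_tl n 0 = path_sum_tl (Suc n) 0"
    using path_sum_tl_Suc_Suc[of k 0] path_sum_max_first_rec[of k 0] n by simp
  then have "real (path_sum n 0) = real (path_sum_tl (Suc n) 0) - real (path_sum_tl (Suc k) 0)"
    using n by simp
  also have "\<dots> = catalan (n + 1) - catalan n"
    using path_sum_tl_eq_ballot[of n 0] path_sum_tl_eq_ballot[of k 0]
      ballot_eq_catalan[of n] ballot_eq_catalan[of k] n by simp
  finally show ?thesis unfolding pf_eq_total .
qed

end
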